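(* Let $f:\mathbb R\to\mathbb R$ be $f(x)=\frac1p|x|^p$ for $p>2$, with minimizer $x^\ast=0$ and $f(x^\ast)=0$. (1) For any step size $0<\eta^{\frac{1}{p-1}}<1$ and any initial position $x_0\in\mathbb R$, rescaled gradient descent of order $p$ minimizes $f$ at an exponential rate: $f(x_k)=\left(1-\eta^{\frac{1}{p-1}}\right)^{pk}f(x_0)$. (2) On the other hand, for any $\eta^{\frac{1}{p-1}}>0$ and $|x_0|<\left(2\eta^{\frac{1}{p-1}}\right)^{-\frac{1}{p-2}}$, gradient descent with step size $\eta^{\frac{1}{p-1}}$ minimizes $f$ at a polynomial rate: $f(x_k)=\Omega\left(\left(\eta^{\frac{1}{p-1}}k\right)^{-\frac{p}{p-2}}\right)$.
   Context: Rescaled gradient descent of order $p$ is the iteration $x_{k+1}=x_k-\eta^{\frac{1}{p-1}}\frac{f'(x_k)}{|f'(x_k)|^{\frac{p-2}{p-1}}}$ (with $x_{k+1}=x_k$ if $f'(x_k)=0$). Gradient descent with step size $\eta^{\frac{1}{p-1}}$ is the iteration $x_{k+1}=x_k-\eta^{\frac{1}{p-1}}f'(x_k)$. Here $k=0,1,2,\dots$ and $\eta>0$. $a_k=\Omega(b_k)$ means that there is a constant $c>0$ (independent of $k$) with $a_k\ge c\,b_k$ for all sufficiently large $k$.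
   Formalization: Part (2) additionally assumes x_0 ≠ 0: if x_0 = 0, gradient descent stays at 0, so f(x_k) = 0 for all k and the claimed Ω lower bound fails. *)

theory Defs
  imports "HOL-Analysis.Analysis" "HOL-Library.Landau_Symbols"
begin

definition rescaled_gradient_descent ::
    "real \<Rightarrow> real \<Rightarrow> (real \<Rightarrow> real) \<Rightarrow> (nat \<Rightarrow> real) \<Rightarrow> bool" where
  "rescaled_gradient_descent p \<eta> f x \<longleftrightarrow>
     (\<forall>k. x (Suc k) =
        (if deriv f (x k) = 0 then x k
         else x k - \<eta> powr (1 / (p - 1)) *
                (deriv f (x k) / \<bar>deriv f (x k)\<bar> powr ((p - 2) / (p - 1)))))"

definition gradient_descent :: "real \<Rightarrow> (real \<Rightarrow> real) \<Rightarrow> (nat \<Rightarrow> real) \<Rightarrow> bool" where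
  "gradient_descent s f x \<longleftrightarrow> (\<forall>k. x (Suc k) = x k - s * deriv f (x k))"

end

theory Submission
  imports Defs
begin

text \<open>Since \<open>f' x = sgn x * \<bar>x\<bar> powr (p - 1)\<close>, the rescaled step is multiplication by \<open>1 - s\<close>, where
  \<open>s\<close> is the step size. A gradient step multiplies \<open>\<bar>x\<bar>\<close> by \<open>1 - s * \<bar>x\<bar> powr (p - 2)\<close>; hence
  \<open>w = \<bar>x\<bar> powr (- (p - 2))\<close> becomes \<open>w * (1 - s / w) powr (- (p - 2))\<close>. As long as
  \<open>s / w \<le> 1 / 2\<close> this is at most \<open>w + C * s\<close> with a constant \<open>C\<close>, so \<open>w\<close> grows at most linearly
  and \<open>\<bar>x\<bar> powr p = w powr (- (p / (p - 2)))\<close> decays at most polynomially.\<close>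

text \<open>At 0 the difference quotient is bounded by \<open>\<bar>h\<bar> powr (p - 1)\<close>,
  which tends to 0 because \<open>p > 1\<close>. Away from 0 the chain rule applies, with
  \<open>sgn x\<close> as the derivative of the absolute value.\<close>

lemma has_real_derivative_abs_powr:
  fixes p x :: real
  assumes "p > 1"
  shows "((\<lambda>x. \<bar>x\<bar> powr p) has_real_derivative p * (sgn x * \<bar>x\<bar> powr (p - 1))) (at x)"
proof (cases "x = 0")
  case True
  have "((\<lambda>h::real. \<bar>h\<bar> powr (p - 1)) \<longlongrightarrow> \<bar>0\<bar> powr (p - 1)) (at 0)"
    using assms by (intro tendsto_powr2 tendsto_intros) auto
  hence lim: "((\<lambda>h::real. \<bar>h\<bar> powr (p - 1)) \<longlongrightarrow> 0) (at 0)"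
    using assms by simp
  have "\<forall>\<^sub>F h::real in at 0. norm ((\<bar>0 + h\<bar> powr p - \<bar>0\<bar> powr p) / h) \<le> \<bar>h\<bar> powr (p - 1)"
    using assms by (simp add: powr_diff)
  hence "((\<lambda>h::real. (\<bar>0 + h\<bar> powr p - \<bar>0\<bar> powr p) / h) \<longlongrightarrow> 0) (at 0)"
    using lim by (rule Lim_null_comparison)
  thus ?thesis
    using True by (simp add: DERIV_def)
next
  case False
  have "(norm has_derivative (\<lambda>h. sgn x * h)) (at x)"
    using has_derivative_norm[OF False] by (simp add: mult.commute)
  hence abs: "(abs has_real_derivative sgn x) (at x)"
    by (simp add: has_field_derivative_def real_norm_def[abs_def])
  have "((\<lambda>x. \<bar>x\<bar> powr p) has_real_derivative p * \<bar>x\<bar> powr (p - 1) * sgn x) (at x)"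
    using False abs by (auto intro!: derivative_eq_intros simp: powr_diff)
  thus ?thesis
    by (simp add: mult_ac)
qed

lemma deriv_abs_powr:
  fixes p x :: real
  assumes "p > 1"
  shows "deriv (\<lambda>x. 1 / p * \<bar>x\<bar> powr p) x = sgn x * \<bar>x\<bar> powr (p - 1)"
  using DERIV_cmult[OF has_real_derivative_abs_powr[OF assms], of "1 / p"] assms
  by (intro DERIV_imp_deriv) simp

lemma rescaled_gradient_descent_abs_powr:
  fixes p \<eta> :: real and x :: "nat \<Rightarrow> real"
  assumes "p > 2"
    and "rescaled_gradient_descent p \<eta> (\<lambda>x. 1 / p * \<bar>x\<bar> powr p) x"
  shows "x k = (1 - \<eta> powr (1 / (p - 1))) ^ k * x 0"
proof (induction k)
  have deriv: "deriv (\<lambda>x. 1 / p * \<bar>x\<bar> powr p) y = sgn y * \<bar>y\<bar> powr (p - 1)" for y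
    using assms(1) by (intro deriv_abs_powr) simp
  case (Suc k)
  have "x (Suc k) = (1 - \<eta> powr (1 / (p - 1))) * x k"
  proof (cases "x k = 0")
    case True
    thus ?thesis
      using assms(2) unfolding rescaled_gradient_descent_def deriv by simp
  next
    case False
    \<comment> \<open>The exponent \<open>(p - 2) / (p - 1)\<close> turns the size
      \<open>\<bar>x k\<bar> powr (p - 1)\<close> of the derivative into
      \<open>\<bar>x k\<bar> powr (p - 2)\<close>, so a single power of
      \<open>\<bar>x k\<bar>\<close> survives the division.\<close>
    have "sgn (x k) * \<bar>x k\<bar> powr (p - 1) / \<bar>sgn (x k) * \<bar>x k\<bar> powr (p - 1)\<bar> powr ((p - 2) / (p - 1))
        = sgn (x k) * (\<bar>x k\<bar> powr (p - 1) / \<bar>x k\<bar> powr (p - 2))"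
      using assms(1) False by (simp add: abs_mult abs_sgn_eq powr_powr)
    also have "\<dots> = sgn (x k) * \<bar>x k\<bar> powr ((p - 1) - (p - 2))"
      by (simp only: powr_diff)
    also have "\<dots> = x k"
      using False by (simp add: sgn_mult_abs)
    finally show ?thesis
      using assms(2) False unfolding rescaled_gradient_descent_def deriv
      by (simp add: sgn_zero_iff algebra_simps)
  qed
  thus ?case
    using Suc.IH by simp
qed simp

text \<open>On [0, 1/2] one has \<open>1 / (1 - t) \<le> exp (2 * t)\<close>, so the left side is at
  most exp u with u = 2qt. This exponential is then linearised by exp u <= 1 + u exp u, and u <= q
  bounds the remaining factor by \<open>exp q\<close>.\<close>

lemma one_minus_powr_neg_le:
  fixes q t :: real
  assumes "q > 0" "0 \<le> t" "t \<le> 1 / 2"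
  shows "(1 - t) powr (- q) \<le> 1 + 2 * q * exp q * t"
proof -
  \<comment> \<open>After clearing the denominator this reads 2 t^2 <= t, which is where t <= 1/2
    enters.\<close>
  have "1 / (1 - t) \<le> 1 + 2 * t"
    using assms mult_mono[of t "1/2" t t] by (simp add: field_simps)
  also have "\<dots> \<le> exp (2 * t)"
    by (rule exp_ge_add_one_self)
  finally have "(1 / (1 - t)) powr q \<le> exp (2 * t) powr q"
    using assms by (intro powr_mono2) auto
  moreover have "(1 / (1 - t)) powr q = (1 - t) powr (- q)"
    using assms by (simp add: powr_divide powr_minus_divide)
  moreover have "exp (2 * t) powr q = exp (2 * q * t)"
    by (simp add: powr_def mult_ac)
  ultimately have "(1 - t) powr (- q) \<le> exp (2 * q * t)"
    by simp
  also have "exp (2 * q * t) \<le> 1 + 2 * q * t * exp (2 * q * t)"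
  proof -
    \<comment> \<open>This is 1 - u <= exp (-u), multiplied by exp u.\<close>
    have "(1 - 2 * q * t) * exp (2 * q * t) \<le> exp (- (2 * q * t)) * exp (2 * q * t)"
      using exp_ge_add_one_self[of "- (2 * q * t)"] by (intro mult_right_mono) auto
    thus ?thesis
      by (simp add: exp_minus field_simps)
  qed
  also have "1 + 2 * q * t * exp (2 * q * t) \<le> 1 + 2 * q * t * exp q"
  proof -
    have "2 * q * t \<le> q"
      using assms mult_left_mono[of t "1 / 2" q] by simp
    thus ?thesis
      using assms by (intro add_left_mono mult_left_mono) simp_all
  qed
  finally show ?thesis
    by (simp add: mult_ac)
qed

lemma gradient_descent_abs_powr_step:
  fixes p s :: real and x :: "nat \<Rightarrow> real"
  assumes "p > 1"
    and "gradient_descent s (\<lambda>x. 1 / p * \<bar>x\<bar> powr p) x"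
  shows "x (Suc k) = x k * (1 - s * \<bar>x k\<bar> powr (p - 2))"
proof (cases "x k = 0")
  case True
  thus ?thesis
    using assms(2) unfolding gradient_descent_def deriv_abs_powr[OF assms(1)] by simp
next
  case False
  have "sgn (x k) * \<bar>x k\<bar> powr (p - 1) = sgn (x k) * \<bar>x k\<bar> powr (1 + (p - 2))"
    by simp
  also have "\<dots> = x k * \<bar>x k\<bar> powr (p - 2)"
    using False by (simp only: powr_add) (simp add: sgn_mult_abs mult.assoc[symmetric])
  finally show ?thesis
    using assms(2) unfolding gradient_descent_def deriv_abs_powr[OF assms(1)]
    by (simp add: right_diff_distrib mult.left_commute)
qed

text \<open>Three facts about w = \<open>\<bar>x k\<bar> powr (- (p - 2))\<close> are carried
  through one induction. The invariant 2s <= w gives s / w <= 1/2, so a step never reaches 0 and the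
  linearised bound applies; each step then adds at most a fixed multiple of s to w. A start at 0 is
  excluded: the iterates would stay there, and no positive lower bound could hold.\<close>

lemma gradient_descent_abs_powr_lower_bound:
  fixes p s :: real and x :: "nat \<Rightarrow> real"
  assumes p: "p > 2" and s: "s > 0"
    and x0: "x 0 \<noteq> 0" "\<bar>x 0\<bar> < (2 * s) powr (- (1 / (p - 2)))"
    and gd: "gradient_descent s (\<lambda>x. 1 / p * \<bar>x\<bar> powr p) x"
  shows "x k \<noteq> 0 \<and> 2 * s \<le> \<bar>x k\<bar> powr (- (p - 2)) \<and>
    \<bar>x k\<bar> powr (- (p - 2)) \<le> \<bar>x 0\<bar> powr (- (p - 2)) + 2 * (p - 2) * exp (p - 2) * s * real k"
proof (induction k)
  case 0
  \<comment> \<open>The negative power \<open>- (p - 2)\<close> reverses the bound on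
    \<open>\<bar>x 0\<bar>\<close> and turns it into the invariant 2s <= w at k = 0.\<close>
  have "((2 * s) powr (- (1 / (p - 2)))) powr (- (p - 2)) \<le> \<bar>x 0\<bar> powr (- (p - 2))"
    using x0 p by (intro powr_mono2') auto
  moreover have "- (1 / (p - 2)) * - (p - 2) = 1"
    using p by (simp add: divide_simps)
  ultimately have "2 * s \<le> \<bar>x 0\<bar> powr (- (p - 2))"
    using s by (simp only: powr_powr) simp
  thus ?case
    using x0 by simp
next
  case (Suc k)
  define q w where "q = p - 2" and "w = \<bar>x k\<bar> powr (- q)"
  have q: "q > 0"
    using p by (simp add: q_def)
  have w: "2 * s \<le> w" "w > 0"
    and w_le: "w \<le> \<bar>x 0\<bar> powr (- q) + 2 * q * exp q * s * real k"
    using Suc.IH by (auto simp: q_def w_def)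
  have t: "0 \<le> s / w" "s / w \<le> 1 / 2"
    using s w by (auto simp: field_simps)
  have xS: "x (Suc k) = x k * (1 - s / w)"
    using gradient_descent_abs_powr_step[OF _ gd, of k] p
    by (simp add: q_def[symmetric] w_def powr_minus divide_inverse)
  have nz: "x (Suc k) \<noteq> 0"
    using xS t Suc.IH by auto
  have "\<bar>1 - s / w\<bar> = 1 - s / w"
    using t by linarith
  hence eq: "\<bar>x (Suc k)\<bar> powr (- q) = w * (1 - s / w) powr (- q)"
    by (simp add: xS abs_mult powr_mult flip: w_def)
  \<comment> \<open>The factor is at least 1, so w does not decrease and the invariant 2s <= w
    passes to the next iterate.\<close>
  have "1 \<le> (1 - s / w) powr (- q)"
    using powr_mono2'[of "- q" "1 - s / w" 1] t q by simp
  hence "w \<le> \<bar>x (Suc k)\<bar> powr (- q)"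
    using w by (simp add: eq)
  \<comment> \<open>The outer w cancels the one in s / w, so the increment of w does not depend on
    the iterate.\<close>
  moreover have "\<bar>x (Suc k)\<bar> powr (- q) \<le> w * (1 + 2 * q * exp q * (s / w))"
    unfolding eq using w by (intro mult_left_mono one_minus_powr_neg_le q t) auto
  hence "\<bar>x (Suc k)\<bar> powr (- q) \<le> w + 2 * q * exp q * s"
    using w by (simp add: distrib_left)
  ultimately show ?case
    using nz w w_le by (simp add: q_def[symmetric] algebra_simps)
qed

lemma gradient_descent_abs_powr_bigomega:
  fixes p s :: real and x :: "nat \<Rightarrow> real"
  assumes p: "p > 2" and s: "s > 0"
    and x0: "x 0 \<noteq> 0" "\<bar>x 0\<bar> < (2 * s) powr (- (1 / (p - 2)))"
    and gd: "gradient_descent s (\<lambda>x. 1 / p * \<bar>x\<bar> powr p) x"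
  shows "(\<lambda>k. 1 / p * \<bar>x k\<bar> powr p) \<in> \<Omega>(\<lambda>k. (s * real k) powr (- (p / (p - 2))))"
proof -
  \<comment> \<open>\<open>C\<close> is the growth of w per step in units of s. \<open>D\<close>
    also absorbs the initial value of w: for \<open>k \<ge> 1\<close> that value is at most k times
    itself, whence w <= D s k.\<close>
  define C D where "C = 2 * (p - 2) * exp (p - 2)" and "D = \<bar>x 0\<bar> powr (- (p - 2)) / s + C"
  have D: "D > 0"
    unfolding C_def D_def using p s x0 by (intro add_pos_pos) auto
  have "D powr (- (p / (p - 2))) / p * (s * real k) powr (- (p / (p - 2))) \<le> 1 / p * \<bar>x k\<bar> powr p"
    if "k \<ge> 1" for k
  proof -
    have xk: "x k \<noteq> 0" "\<bar>x k\<bar> powr (- (p - 2)) \<le> \<bar>x 0\<bar> powr (- (p - 2)) + C * s * real k"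
      using gradient_descent_abs_powr_lower_bound[OF assms, of k] by (auto simp: C_def)
    have "\<bar>x 0\<bar> powr (- (p - 2)) * 1 \<le> \<bar>x 0\<bar> powr (- (p - 2)) * real k"
      using that by (intro mult_left_mono) auto
    moreover have "D * (s * real k) = \<bar>x 0\<bar> powr (- (p - 2)) * real k + C * s * real k"
      using s by (simp add: D_def distrib_right)
    ultimately have "\<bar>x k\<bar> powr (- (p - 2)) \<le> D * (s * real k)"
      using xk(2) by simp
    \<comment> \<open>The negative exponent reverses the upper bound on w into a lower bound on
      \<open>\<bar>x k\<bar> powr p\<close>.\<close>
    hence "(D * (s * real k)) powr (- (p / (p - 2))) \<le> (\<bar>x k\<bar> powr (- (p - 2))) powr (- (p / (p - 2)))"
      using xk(1) p by (intro powr_mono2') auto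
    moreover have "- (p - 2) * - (p / (p - 2)) = p"
      using p by (simp add: field_simps)
    hence "(\<bar>x k\<bar> powr (- (p - 2))) powr (- (p / (p - 2))) = \<bar>x k\<bar> powr p"
      by (simp only: powr_powr)
    ultimately show ?thesis
      using p D s by (simp add: powr_mult divide_right_mono)
  qed
  hence "\<forall>\<^sub>F k in sequentially. D powr (- (p / (p - 2))) / p * norm ((s * real k) powr (- (p / (p - 2))))
      \<le> norm (1 / p * \<bar>x k\<bar> powr p)"
    using p by (intro eventually_sequentiallyI[of 1]) simp
  thus ?thesis
    using D p by (intro landau_omega.bigI[of "D powr (- (p / (p - 2))) / p"]) simp_all
qed

theorem proposition6:
  fixes p \<eta> :: real and f :: "real \<Rightarrow> real"
  assumes "p > 2" and "\<eta> > 0"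
    and "f = (\<lambda>x. 1 / p * \<bar>x\<bar> powr p)"
  shows "is_arg_min f (\<lambda>_. True) 0 \<and> f 0 = 0 \<and>
    (\<forall>x :: nat \<Rightarrow> real.
       0 < \<eta> powr (1 / (p - 1)) \<and> \<eta> powr (1 / (p - 1)) < 1 \<and>
       rescaled_gradient_descent p \<eta> f x \<longrightarrow>
       (\<forall>k. f (x k) = (1 - \<eta> powr (1 / (p - 1))) powr (p * real k) * f (x 0))) \<and>
    (\<forall>x :: nat \<Rightarrow> real.
       \<eta> powr (1 / (p - 1)) > 0 \<and>
       x 0 \<noteq> 0 \<and>
       \<bar>x 0\<bar> < (2 * \<eta> powr (1 / (p - 1))) powr (- (1 / (p - 2))) \<and>
       gradient_descent (\<eta> powr (1 / (p - 1))) f x \<longrightarrow>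
       (\<lambda>k. f (x k)) \<in> \<Omega>(\<lambda>k. (\<eta> powr (1 / (p - 1)) * real k) powr (- (p / (p - 2)))))"
proof (intro conjI allI impI)
  show "is_arg_min f (\<lambda>_. True) 0"
    using assms by (auto simp: is_arg_min_def not_less)
  show "f 0 = 0"
    by (simp add: assms(3))
next
  fix x :: "nat \<Rightarrow> real" and k
  let ?r = "1 - \<eta> powr (1 / (p - 1))"
  assume *: "0 < \<eta> powr (1 / (p - 1)) \<and> \<eta> powr (1 / (p - 1)) < 1 \<and>
    rescaled_gradient_descent p \<eta> f x"
  have "x k = ?r ^ k * x 0"
    using * assms rescaled_gradient_descent_abs_powr by blast
  \<comment> \<open>A step size below 1 makes \<open>?r\<close> positive, so the absolute value
    drops and the natural power becomes a \<open>powr\<close>.\<close>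
  moreover have "\<bar>?r ^ k\<bar> powr p = ?r powr (p * real k)"
    using * by (simp add: powr_realpow[symmetric] powr_powr mult.commute)
  ultimately show "f (x k) = ?r powr (p * real k) * f (x 0)"
    using * by (simp add: assms(3) abs_mult powr_mult)
next
  fix x :: "nat \<Rightarrow> real"
  assume "\<eta> powr (1 / (p - 1)) > 0 \<and> x 0 \<noteq> 0 \<and>
    \<bar>x 0\<bar> < (2 * \<eta> powr (1 / (p - 1))) powr (- (1 / (p - 2))) \<and>
    gradient_descent (\<eta> powr (1 / (p - 1))) f x"
  thus "(\<lambda>k. f (x k)) \<in> \<Omega>(\<lambda>k. (\<eta> powr (1 / (p - 1)) * real k) powr (- (p / (p - 2))))"
    using gradient_descent_abs_powr_bigomega assms by blast
qed

end
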